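(* Let $m\ge 1$ and $0<i\le m$ be integers. The function $x\mapsto r_{i,m}(x)$ is strictly increasing on $[0,\infty)$.
   Context: For integers $n$ and $k$ (with $n$ possibly zero or negative), let $\binom{n}{k}=0$ if $k<0$, $\binom{n}{0}=1$, and $\binom{n}{k}=\frac{1}{k!}\prod_{l=0}^{k-1}(n-l)$ if $k>0$; and let $\left(\!\binom{n}{k}\!\right)=\binom{n+k-1}{k}$. For an integer $m\ge 1$ and any integer $a$, let $\Lambda_m(a)$ be the $(m+1)\times(m+1)$ matrix whose $(p,q)$ entry is $\left(\!\binom{a}{m+2-p-q}\!\right)$, $1\le p,q\le m+1$. Every real $x$ has a continued fraction $x=[c_1,c_2,\dots]=c_1+\cfrac{1}{c_2+\cdots}$ with $c_1=\lfloor x\rfloor$ (possibly zero or negative), and, if $x$ is not an integer, $[c_2,c_3,\dots]$ the usual continued fraction (with positive integer entries) of $\frac{1}{x-\lfloor x\rfloor}>1$. For rational $x=[c_1,\dots,c_n]$, let $X=\Lambda_m(c_1)\cdots\Lambda_m(c_n)$; the numbers $r_{i,m}(x)$, $0\le i\le m$, are defined by $$(r_{m,m}(x),r_{m-1,m}(x),\dots,r_{1,m}(x),r_{0,m}(x))^\top=\frac{1}{X_{m+1,1}}\,(\text{first column of }X),$$ so $r_{0,m}(x)=1$. For irrational $x$ with convergents $x_n=[c_1,\dots,c_n]$, define $r_{i,m}(x)=\lim_{n\to\infty}r_{i,m}(x_n)$; this limit is known to exist. *)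

theory Defs
  imports Complex_Main "Jordan_Normal_Form.Matrix"
begin

definition binom :: "int \<Rightarrow> int \<Rightarrow> real" where
  "binom n k = (if k < 0 then 0 else (of_int n gchoose nat k))"

definition multichoose :: "int \<Rightarrow> int \<Rightarrow> real" where
  "multichoose n k = binom (n + k - 1) k"

(* Rows and columns of mat are numbered from 0, so p + 1 and q + 1 are the usual indices. *)
definition Lambda :: "nat \<Rightarrow> int \<Rightarrow> real mat" where
  "Lambda m a = mat (m + 1) (m + 1)
     (\<lambda>(p, q). multichoose a (int m + 2 - int (p + 1) - int (q + 1)))"

definition Lambda_prod :: "nat \<Rightarrow> int list \<Rightarrow> real mat" where
  "Lambda_prod m cs = foldr (\<lambda>c X. Lambda m c * X) cs (1\<^sub>m (m + 1))"

(* Only meaningful as long as no earlier complete quotient is an integer. *)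
fun complete_quotient :: "real \<Rightarrow> nat \<Rightarrow> real" where
  "complete_quotient x 0 = x"
| "complete_quotient x (Suc n) =
     1 / (complete_quotient x n - of_int \<lfloor>complete_quotient x n\<rfloor>)"

(* The first n partial quotients c_1, ..., c_n of x. *)
definition cfrac_take :: "nat \<Rightarrow> real \<Rightarrow> int list" where
  "cfrac_take n x = map (\<lambda>j. \<lfloor>complete_quotient x j\<rfloor>) [0..<n]"

(* The whole expansion of a rational number: it stops at the first integral complete quotient.
   Hence the last entry is at least 2 if there is more than one entry. *)
definition cfrac_list :: "real \<Rightarrow> int list" where
  "cfrac_list x = cfrac_take (Suc (LEAST n. complete_quotient x n \<in> \<int>)) x"

(* The value on the empty list is a dummy. *)
fun cfrac_value :: "int list \<Rightarrow> real" where
  "cfrac_value [] = 0"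
| "cfrac_value [c] = of_int c"
| "cfrac_value (c # d # cs) = of_int c + 1 / cfrac_value (d # cs)"

definition higher_cf_rat :: "nat \<Rightarrow> nat \<Rightarrow> real \<Rightarrow> real" where
  "higher_cf_rat i m x =
     (let X = Lambda_prod m (cfrac_list x) in X $$ (m - i, 0) / X $$ (m, 0))"

(* The number r_{i,m}(x), for i \<le> m. A convergent is treated as a rational number in its own right:
   its own expansion differs from the truncated one when the latter ends in 1. *)
definition higher_cf :: "nat \<Rightarrow> nat \<Rightarrow> real \<Rightarrow> real" where
  "higher_cf i m x =
     (if x \<in> \<rat> then higher_cf_rat i m x
      else lim (\<lambda>n. higher_cf_rat i m (cfrac_value (cfrac_take (Suc n) x))))"

end

theory Submission
  imports Defs
begin

text \<open>
  Read from the bottom up, the first column of \<open>\<Lambda>\<^sub>m(c\<^sub>1) \<dots> \<Lambda>\<^sub>m(c\<^sub>n)\<close> is a vector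
  \<open>(w\<^sub>0, \<dots>, w\<^sub>m)\<close> with \<open>r\<^sub>i = w\<^sub>i / w\<^sub>0\<close>. The identity
  \<open>\<Sum>\<^sub>k (multichoose c k) t^k = (1 - t)^(-c)\<close> says that \<open>\<Lambda>\<^sub>m(c)\<close> reverses this vector and then takes
  prefix sums \<open>c\<close> times (for \<open>c \<ge> 0\<close>). On rational numbers, therefore, \<open>x \<mapsto> x + 1\<close> corresponds to prefix sums
  (\<open>rat_vec_add_1\<close>) and \<open>x \<mapsto> 1 / x\<close> to reversal (\<open>rat_vec_inverse\<close>), and these two moves produce
  every positive rational number from 1 (\<open>rational_pos_induct\<close>).

  Strict monotonicity of a single coordinate is not preserved by the two moves; the right induction
  hypothesis is that all \<open>2 \<times> 2\<close> minors of the pair of vectors belonging to \<open>x < y\<close> are positive,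
  that is, that the coordinatewise quotient of the two vectors is strictly monotone in the index
  (the likelihood ratio order). Prefix sums preserve this, reversal of both vectors flips it, just
  as \<open>x \<mapsto> 1 / x\<close> flips the order. The induction bottoms out at pairs separated by 1, where the
  vector of \<open>x\<close> decreases and that of \<open>y\<close> increases in the index, while the vector of 1 is
  constant (\<open>ratio_less_rat_vec\<close>).

  For irrational \<open>x\<close>, two consecutive factors form a matrix that agrees with a matrix of rank one
  up to a factor in \<open>[1, m + 1]\<close>, however large the partial quotients are. As in Birkhoff's
  contraction theorem, each such pair multiplies the relative deviation of two vectors from being
  proportional by at most \<open>1 - 1 / (m + 1)\<close> (\<open>two_steps_contract\<close>), so the defining sequence of \<open>r\<^sub>i(x)\<close> converges. Since
  \<open>r\<^sub>1\<close> for \<open>m = 1\<close> is the identity, the same contraction shows that the convergents tend to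
  \<open>x\<close>. Hence they eventually lie on the correct side of any rational \<open>p \<noteq> x\<close>, and the limit
  compares weakly with \<open>r\<^sub>i(p)\<close>. Two rational numbers between \<open>x\<close> and \<open>y\<close> restore strictness.
\<close>

(* Keeps int (i - j) intact, so that the facts about multichoose with a natural index apply. *)
declare of_nat_diff [simp del]


section \<open>Multiset coefficients\<close>

lemma multichoose_0_right [simp]: "multichoose c 0 = 1"
  by (simp add: multichoose_def binom_def)

lemma multichoose_0_left: "multichoose 0 (int k) = (if k = 0 then 1 else 0)"
proof (cases k)
  case (Suc l)
  have "(real l gchoose Suc l) = 0"
    by (metis binomial_eq_0 binomial_gbinomial lessI of_nat_0)
  moreover have "nat (1 + int l) = Suc l" by simp
  ultimately show ?thesis using Suc by (simp add: multichoose_def binom_def)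
qed (simp add: multichoose_def binom_def)

lemma multichoose_neg: "k < 0 \<Longrightarrow> multichoose c k = 0"
  by (simp add: multichoose_def binom_def)

text \<open>In terms of generating functions, \<open>(1 - t) (1 - t)^(-(c + 1)) = (1 - t)^(-c)\<close>.\<close>

lemma multichoose_Pascal:
  "multichoose (c + 1) (int (Suc k)) = multichoose c (int (Suc k)) + multichoose (c + 1) (int k)"
proof -
  have "((of_int c + real k + 1) gchoose Suc k)
      = ((of_int c + real k) gchoose k) + ((of_int c + real k) gchoose Suc k)"
    by (rule gbinomial_Suc_Suc)
  moreover have "nat (1 + int k) = Suc k" by simp
  ultimately show ?thesis
    by (simp add: multichoose_def binom_def algebra_simps)
qed

lemma multichoose_nonneg: "0 \<le> c \<Longrightarrow> 0 \<le> multichoose c (int k)"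
proof (induction c arbitrary: k rule: int_ge_induct)
  case base
  then show ?case by (simp add: multichoose_0_left)
next
  case (step c)
  show ?case
  proof (induction k)
    case (Suc k)
    then show ?case using step.IH[of "Suc k"] multichoose_Pascal[of c k] by linarith
  qed simp
qed

lemma multichoose_mono:
  assumes "1 \<le> c" and "k \<le> l"
  shows "multichoose c (int k) \<le> multichoose c (int l)"
proof -
  have "multichoose c (int k) \<le> multichoose c (int (Suc k))" for k
    using multichoose_Pascal[of "c - 1" k] multichoose_nonneg[of "c - 1" "Suc k"] assms(1) by simp
  then show ?thesis using lift_Suc_mono_le[of "\<lambda>k. multichoose c (int k)"] assms(2) by blast
qed

lemma multichoose_ge_1: "1 \<le> c \<Longrightarrow> 1 \<le> multichoose c (int k)"
  using multichoose_mono[of c 0 k] by simp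


section \<open>The first column of the matrix product\<close>

text \<open>
  Index \<open>i\<close> of a vector stands for row \<open>m - i\<close> of the matrix, so that it matches the index of
  \<open>r\<^sub>i\<close>. In this convention \<open>\<Lambda>\<^sub>m(c)\<close> is a reversal followed by convolution with the coefficients
  of \<open>(1 - t)^(-c)\<close>. Only the indices up to \<open>m\<close> are meaningful.
\<close>

definition cf_step :: "nat \<Rightarrow> int \<Rightarrow> (nat \<Rightarrow> real) \<Rightarrow> nat \<Rightarrow> real" where
  "cf_step m c w i = (\<Sum>j\<le>i. multichoose c (int (i - j)) * w (m - j))"

definition cf_vec :: "nat \<Rightarrow> int list \<Rightarrow> nat \<Rightarrow> real" where
  "cf_vec m cs = foldr (cf_step m) cs (\<lambda>i. if i = m then 1 else 0)"

lemma cf_vec_Nil: "cf_vec m [] = (\<lambda>i. if i = m then 1 else 0)"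
  by (simp add: cf_vec_def)

lemma cf_vec_Cons: "cf_vec m (c # cs) = cf_step m c (cf_vec m cs)"
  by (simp add: cf_vec_def)

lemma Lambda_prod_carrier: "Lambda_prod m cs \<in> carrier_mat (m + 1) (m + 1)"
proof (induction cs)
  case (Cons c cs)
  have "Lambda m c \<in> carrier_mat (m + 1) (m + 1)" by (simp add: Lambda_def)
  then have "Lambda m c * Lambda_prod m cs \<in> carrier_mat (m + 1) (m + 1)"
    by (rule mult_carrier_mat[OF _ Cons.IH])
  then show ?case unfolding Lambda_prod_def foldr.simps o_apply .
qed (simp add: Lambda_prod_def)

lemma Lambda_prod_eq_cf_vec: "i \<le> m \<Longrightarrow> Lambda_prod m cs $$ (m - i, 0) = cf_vec m cs i"
proof (induction cs arbitrary: i)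
  case Nil
  then show ?case by (auto simp: Lambda_prod_def cf_vec_Nil)
next
  case (Cons c cs)
  define X where "X = Lambda_prod m cs"
  have X: "X \<in> carrier_mat (m + 1) (m + 1)" unfolding X_def by (rule Lambda_prod_carrier)
  have IH: "X $$ (j, 0) = cf_vec m cs (m - j)" if "j \<le> m" for j
    using Cons.IH[of "m - j"] that by (simp add: X_def)
  have "Lambda_prod m (c # cs) $$ (m - i, 0) = (Lambda m c * X) $$ (m - i, 0)"
    by (simp add: Lambda_prod_def X_def)
  also have "\<dots> = (\<Sum>j\<in>{0..<m + 1}. Lambda m c $$ (m - i, j) * X $$ (j, 0))"
    using X by (auto simp: Lambda_def scalar_prod_def intro!: sum.cong)
  also have "\<dots> = (\<Sum>j\<in>{..m}. multichoose c (int i - int j) * cf_vec m cs (m - j))"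
  proof (rule sum.cong)
    fix j assume j: "j \<in> {..m}"
    have "int m + 2 - int (m - i + 1) - int (j + 1) = int i - int j"
      using Cons.prems by (simp add: of_nat_diff)
    then show "Lambda m c $$ (m - i, j) * X $$ (j, 0)
        = multichoose c (int i - int j) * cf_vec m cs (m - j)"
      using j by (simp add: Lambda_def IH)
  qed auto
  also have "\<dots> = (\<Sum>j\<in>{..i}. multichoose c (int i - int j) * cf_vec m cs (m - j))"
    using Cons.prems by (intro sum.mono_neutral_right) (auto simp: multichoose_neg)
  also have "\<dots> = cf_vec m (c # cs) i"
    unfolding cf_vec_Cons cf_step_def by (intro sum.cong) (auto simp: of_nat_diff)
  finally show ?case .
qed

lemma cf_step_cong:
  assumes "\<And>i. i \<le> m \<Longrightarrow> u i = v i"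
  shows "cf_step m c u = cf_step m c v"
  unfolding cf_step_def using assms by auto

lemma cf_step_0: "cf_step m 0 w i = w (m - i)"
proof -
  have "cf_step m 0 w i = (\<Sum>j\<le>i. if j = i then w (m - i) else 0)"
    unfolding cf_step_def by (intro sum.cong) (auto simp: multichoose_0_left)
  then show ?thesis by simp
qed

lemma cf_step_at_0 [simp]: "cf_step m c w 0 = w m"
  by (simp add: cf_step_def)

text \<open>One more factor \<open>1 / (1 - t)\<close> in the generating function amounts to taking prefix sums.\<close>

lemma cf_step_add_1: "cf_step m (c + 1) w i = (\<Sum>j\<le>i. cf_step m c w j)"
proof (induction i)
  case (Suc i)
  have "cf_step m (c + 1) w (Suc i)
      = (\<Sum>j\<le>i. multichoose (c + 1) (int (Suc (i - j))) * w (m - j)) + w (m - Suc i)"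
    by (simp add: cf_step_def Suc_diff_le del: of_nat_Suc)
  also have "\<dots> = (\<Sum>j\<le>i. multichoose c (int (Suc (i - j))) * w (m - j)) + w (m - Suc i)
      + cf_step m (c + 1) w i"
    unfolding multichoose_Pascal by (simp add: cf_step_def algebra_simps sum.distrib del: of_nat_Suc)
  also have "(\<Sum>j\<le>i. multichoose c (int (Suc (i - j))) * w (m - j)) + w (m - Suc i)
      = cf_step m c w (Suc i)"
    by (simp add: cf_step_def Suc_diff_le del: of_nat_Suc)
  finally show ?case using Suc by simp
qed simp

lemma cf_step_diff:
  "cf_step m c (\<lambda>i. a * u i - b * v i) i = a * cf_step m c u i - b * cf_step m c v i"
  by (simp add: cf_step_def sum_subtractf sum_distrib_left algebra_simps)

lemma cf_step_nonneg:
  "0 \<le> c \<Longrightarrow> (\<And>i. i \<le> m \<Longrightarrow> 0 \<le> w i) \<Longrightarrow> 0 \<le> cf_step m c w i"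
  unfolding cf_step_def by (auto intro!: sum_nonneg mult_nonneg_nonneg multichoose_nonneg)

lemma cf_step_mono_vec:
  "0 \<le> c \<Longrightarrow> (\<And>i. i \<le> m \<Longrightarrow> u i \<le> v i) \<Longrightarrow> cf_step m c u i \<le> cf_step m c v i"
  unfolding cf_step_def by (auto intro!: sum_mono mult_left_mono multichoose_nonneg)

lemma cf_step_ge_first:
  assumes "0 \<le> c" and "\<And>i. i \<le> m \<Longrightarrow> 0 \<le> w i"
  shows "multichoose c (int i) * w m \<le> cf_step m c w i"
proof -
  have "(\<Sum>j\<in>{0}. multichoose c (int (i - j)) * w (m - j)) \<le> cf_step m c w i"
    unfolding cf_step_def
    by (rule sum_mono2) (use assms in \<open>auto intro!: mult_nonneg_nonneg multichoose_nonneg\<close>)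
  then show ?thesis by simp
qed

text \<open>
  For \<open>c \<ge> 1\<close> the power \<open>(1 - t)^(-c)\<close> contains a factor \<open>1 / (1 - t)\<close>, so at least one prefix sum
  of a nonnegative vector is taken.
\<close>

lemma cf_step_mono_index:
  assumes "1 \<le> c" and "\<And>i. i \<le> m \<Longrightarrow> 0 \<le> w i" and "k \<le> l"
  shows "cf_step m c w k \<le> cf_step m c w l"
proof -
  have "cf_step m c w k \<le> (\<Sum>j\<le>k. multichoose c (int (l - j)) * w (m - j))"
    unfolding cf_step_def
    using assms by (intro sum_mono mult_right_mono multichoose_mono) auto
  also have "\<dots> \<le> cf_step m c w l"
    unfolding cf_step_def
    by (rule sum_mono2) (use assms in \<open>auto intro!: mult_nonneg_nonneg multichoose_nonneg\<close>)
  finally show ?thesis .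
qed

text \<open>
  These are the vectors that every factor with \<open>c \<ge> 1\<close> turns into a positive one. Beside positive
  vectors they include the last unit vector, from which every product starts.
\<close>

definition admissible :: "nat \<Rightarrow> (nat \<Rightarrow> real) \<Rightarrow> bool" where
  "admissible m w \<longleftrightarrow> (\<forall>i\<le>m. 0 \<le> w i) \<and> 0 < w m"

lemma cf_step_pos:
  assumes "1 \<le> c" and "admissible m w"
  shows "0 < cf_step m c w i"
proof -
  have "1 * w m \<le> multichoose c (int i) * w m"
    using assms multichoose_ge_1[of c i] by (intro mult_right_mono) (auto simp: admissible_def)
  also have "\<dots> \<le> cf_step m c w i"
    using assms by (intro cf_step_ge_first) (auto simp: admissible_def)
  finally show ?thesis using assms by (simp add: admissible_def)
qed

lemma admissible_foldr:
  assumes "\<forall>c\<in>set cs. 1 \<le> c" and "admissible m w"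
  shows "admissible m (foldr (cf_step m) cs w)"
  using assms
proof (induction cs)
  case (Cons c cs)
  then have "0 < cf_step m c (foldr (cf_step m) cs w) i" for i by (intro cf_step_pos) auto
  then show ?case by (simp add: admissible_def less_imp_le)
qed simp

lemma admissible_seed: "admissible m (\<lambda>i. if i = m then 1 else 0)"
  by (simp add: admissible_def)


section \<open>Expansions of nonnegative rational numbers\<close>

text \<open>
  This is the subtractive Euclidean algorithm. Unlike an induction on the continued fraction it does
  not mention the form of the expansion, which makes its special last entry harmless.
\<close>

lemma rational_pos_induct [consumes 2, case_names one add_1 inverse]:
  fixes x :: real
  assumes "x \<in> \<rat>" and "0 < x"
    and one: "P 1"
    and add_1: "\<And>x. x \<in> \<rat> \<Longrightarrow> 0 < x \<Longrightarrow> P x \<Longrightarrow> P (x + 1)"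
    and inverse: "\<And>x. x \<in> \<rat> \<Longrightarrow> 0 < x \<Longrightarrow> P x \<Longrightarrow> P (1 / x)"
  shows "P x"
proof -
  have *: "P (real a / real b)" if "0 < a" "0 < b" for a b
    using that
  proof (induction "a + b" arbitrary: a b rule: less_induct)
    case less
    have sub: "P (real a / real b)"
      if ab: "b < a" "0 < b" and IH: "P (real (a - b) / real b)" for a b :: nat
    proof -
      have "real a / real b = real (a - b) / real b + 1"
        using ab by (simp add: of_nat_diff field_simps)
      then show ?thesis using ab IH add_1[of "real (a - b) / real b"] by (simp add: of_nat_diff)
    qed
    consider "a = b" | "b < a" | "a < b" by linarith
    then show ?case
    proof cases
      case 1
      then show ?thesis using less.prems one by simp
    next
      case 2
      then show ?thesis using less.prems less.hyps[of "a - b" b] sub by simp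
    next
      case 3
      then have "P (real b / real a)" using less.prems less.hyps[of "b - a" a] sub by simp
      then show ?thesis using inverse[of "real b / real a"] less.prems by simp
    qed
  qed
  obtain a b :: int where ab: "b > 0" "x = of_int a / of_int b"
    using assms(1) by (metis Rats_cases')
  then have "a > 0" using assms(2) by (simp add: zero_less_divide_iff)
  then show ?thesis using *[of "nat a" "nat b"] ab by simp
qed

lemma complete_quotient_Suc_shift:
  "complete_quotient x (Suc n) = complete_quotient (1 / frac x) n"
  by (induction n) (simp_all add: frac_def)

lemma complete_quotient_add_1: "complete_quotient (x + 1) (Suc n) = complete_quotient x (Suc n)"
  unfolding complete_quotient_Suc_shift by (simp add: frac_def)

lemma not_Ints_between_0_1: "0 < x \<Longrightarrow> x < 1 \<Longrightarrow> (x :: real) \<notin> \<int>"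
  by (auto elim!: Ints_cases)

lemma frac_less_1_id: "0 \<le> x \<Longrightarrow> x < 1 \<Longrightarrow> frac (x :: real) = x"
  by (simp add: frac_eq)

text \<open>
  Adding 1 changes only the first partial quotient, and inversion prepends or removes a leading 0.
\<close>

lemma rational_expansion_terminates:
  assumes "x \<in> \<rat>" and "0 \<le> x"
  shows "\<exists>n. complete_quotient x n \<in> \<int>"
proof (cases "x = 0")
  case True
  then have "complete_quotient x 0 \<in> \<int>" by simp
  then show ?thesis by blast
next
  case False
  with assms have "0 < x" by simp
  from assms(1) this show ?thesis
  proof (induction rule: rational_pos_induct)
    case one
    have "complete_quotient 1 0 \<in> \<int>" by simp
    then show ?case by blast
  next
    case (add_1 x)
    then obtain n where n: "complete_quotient x n \<in> \<int>" by blast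
    show ?case
    proof (cases n)
      case 0
      then have "complete_quotient (x + 1) 0 \<in> \<int>" using n by simp
      then show ?thesis by blast
    next
      case (Suc k)
      then show ?thesis using n complete_quotient_add_1[of x k] by metis
    qed
  next
    case (inverse x)
    then obtain n where n: "complete_quotient x n \<in> \<int>" by blast
    consider "x = 1" | "1 < x" | "x < 1" by linarith
    then show ?case
    proof cases
      case 1
      then show ?thesis using n by auto
    next
      case 2
      then have "complete_quotient (1 / x) (Suc n) = complete_quotient x n"
        unfolding complete_quotient_Suc_shift by (simp add: frac_less_1_id)
      then show ?thesis using n by metis
    next
      case 3
      then obtain k where "n = Suc k"
        using n inverse.hyps not_Ints_between_0_1[of x] by (cases n) auto
      then have "complete_quotient x n = complete_quotient (1 / x) k"
        using 3 inverse.hyps by (simp only: complete_quotient_Suc_shift) (simp add: frac_less_1_id)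
      then show ?thesis using n by metis
    qed
  qed
qed

lemma cfrac_take_Suc: "cfrac_take (Suc n) x = \<lfloor>x\<rfloor> # cfrac_take n (1 / frac x)"
proof -
  have "[0..<Suc n] = 0 # map Suc [0..<n]" by (simp add: upt_conv_Cons map_Suc_upt del: upt_Suc)
  then show ?thesis
    unfolding cfrac_take_def
    by (simp add: complete_quotient_Suc_shift o_def del: upt_Suc complete_quotient.simps(2))
qed

lemma cfrac_list_Ints: "x \<in> \<int> \<Longrightarrow> cfrac_list x = [\<lfloor>x\<rfloor>]"
proof -
  assume "x \<in> \<int>"
  then have "(LEAST n. complete_quotient x n \<in> \<int>) = 0" by (intro Least_eq_0) simp
  then show ?thesis by (simp add: cfrac_list_def cfrac_take_def)
qed

lemma cfrac_list_not_Ints: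
  assumes "x \<in> \<rat>" and "0 \<le> x" and "x \<notin> \<int>"
  shows "cfrac_list x = \<lfloor>x\<rfloor> # cfrac_list (1 / frac x)"
proof -
  obtain n where "complete_quotient x n \<in> \<int>"
    using rational_expansion_terminates[OF assms(1,2)] by blast
  then have "(LEAST n. complete_quotient x n \<in> \<int>)
      = Suc (LEAST n. complete_quotient x (Suc n) \<in> \<int>)"
    by (rule Least_Suc) (use assms in simp)
  then show ?thesis
    unfolding cfrac_list_def cfrac_take_Suc[of _ x] complete_quotient_Suc_shift by simp
qed

abbreviation rat_vec :: "nat \<Rightarrow> real \<Rightarrow> nat \<Rightarrow> real" where
  "rat_vec m x \<equiv> cf_vec m (cfrac_list x)"

lemma higher_cf_rat_eq:
  "i \<le> m \<Longrightarrow> higher_cf_rat i m x = rat_vec m x i / rat_vec m x 0"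
  unfolding higher_cf_rat_def Let_def
  using Lambda_prod_eq_cf_vec[of i m] Lambda_prod_eq_cf_vec[of 0 m] by simp

lemma rat_vec_of_int: "rat_vec m (of_int c) = cf_step m c (cf_vec m [])"
  by (simp add: cfrac_list_Ints cf_vec_Cons)

lemma rat_vec_not_Ints:
  "x \<in> \<rat> \<Longrightarrow> 0 \<le> x \<Longrightarrow> x \<notin> \<int> \<Longrightarrow>
    rat_vec m x = cf_step m \<lfloor>x\<rfloor> (rat_vec m (1 / frac x))"
  by (simp add: cfrac_list_not_Ints cf_vec_Cons)

lemma rat_vec_0: "i \<le> m \<Longrightarrow> rat_vec m 0 i = (if i = 0 then 1 else 0)"
  using rat_vec_of_int[of m 0] by (auto simp: cf_step_0 cf_vec_Nil)

lemma rat_vec_add_1: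
  assumes "x \<in> \<rat>" and "0 \<le> x"
  shows "rat_vec m (x + 1) i = (\<Sum>j\<le>i. rat_vec m x j)"
proof (cases "x \<in> \<int>")
  case True
  then obtain c where "x = of_int c" by (elim Ints_cases)
  moreover from this have "x + 1 = of_int (c + 1)" by simp
  ultimately show ?thesis using cf_step_add_1 rat_vec_of_int by metis
next
  case False
  then have "x + 1 \<notin> \<int>" by (metis Ints_1 Ints_diff add_diff_cancel_right')
  moreover have "x + 1 \<in> \<rat>" using assms by simp
  moreover have "frac (x + 1) = frac x" by (simp add: frac_def)
  ultimately show ?thesis
    using assms False by (simp add: rat_vec_not_Ints cf_step_add_1)
qed

lemma rat_vec_1: "i \<le> m \<Longrightarrow> rat_vec m 1 i = 1"
  using rat_vec_add_1[of 0 m i] by (simp add: rat_vec_0 sum.delta)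

text \<open>
  For \<open>x > 1\<close> the expansion of \<open>1 / x\<close> is that of \<open>x\<close> with a 0 in front, and \<open>\<Lambda>\<^sub>m(0)\<close> is the
  reversal. The case \<open>x < 1\<close> is the same statement for \<open>1 / x\<close>.
\<close>

lemma rat_vec_inverse:
  assumes "x \<in> \<rat>" and "0 < x" and "i \<le> m"
  shows "rat_vec m (1 / x) i = rat_vec m x (m - i)"
proof -
  have gt1: "rat_vec m (1 / x) i = rat_vec m x (m - i)" if "x \<in> \<rat>" "1 < x" for x i
  proof -
    have "1 / x \<notin> \<int>" using that by (intro not_Ints_between_0_1) auto
    moreover have "frac (1 / x) = 1 / x" using that by (intro frac_less_1_id) auto
    moreover have "\<lfloor>1 / x\<rfloor> = 0" using that by (simp add: floor_eq_iff)
    ultimately show ?thesis using that by (simp add: rat_vec_not_Ints cf_step_0)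
  qed
  consider "x = 1" | "1 < x" | "x < 1" by linarith
  then show ?thesis
  proof cases
    case 1
    then show ?thesis using assms by (simp add: rat_vec_1)
  next
    case 2
    then show ?thesis using gt1 assms by blast
  next
    case 3
    then show ?thesis using gt1[of "1 / x" "m - i"] assms by simp
  qed
qed

lemma rat_vec_pos:
  assumes "x \<in> \<rat>" and "0 < x" and "i \<le> m"
  shows "0 < rat_vec m x i"
proof -
  from assms(1,2) have "\<forall>i\<le>m. 0 < rat_vec m x i"
  proof (induction rule: rational_pos_induct)
    case one
    then show ?case by (simp add: rat_vec_1)
  next
    case (add_1 x)
    then show ?case by (auto simp: rat_vec_add_1 intro!: sum_pos)
  next
    case (inverse x)
    then show ?case by (simp add: rat_vec_inverse)
  qed
  then show ?thesis using assms(3) by blast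
qed


section \<open>Strict monotonicity at rational arguments\<close>

text \<open>
  For positive vectors this says that \<open>v i / u i\<close> increases strictly with \<open>i\<close>. Comparing with index
  0 gives \<open>u i / u 0 < v i / v 0\<close>, but only the comparison of all pairs of indices is stable under
  prefix sums and reversal.
\<close>

definition ratio_less :: "nat \<Rightarrow> (nat \<Rightarrow> real) \<Rightarrow> (nat \<Rightarrow> real) \<Rightarrow> bool" where
  "ratio_less m u v \<longleftrightarrow> (\<forall>k l. k < l \<longrightarrow> l \<le> m \<longrightarrow> u l * v k < u k * v l)"

lemma ratio_less_reverse:
  "ratio_less m u v \<Longrightarrow> ratio_less m (\<lambda>i. v (m - i)) (\<lambda>i. u (m - i))"
  unfolding ratio_less_def by (simp add: mult.commute)

text \<open>
  In a \<open>2 \<times> 2\<close> minor of the prefix sums the terms with both indices at most \<open>k\<close> cancel. What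
  remains is a sum of minors of \<open>u\<close> and \<open>v\<close> with one index up to \<open>k\<close> and the other beyond it, all
  of the same sign.
\<close>

lemma ratio_less_prefix_sums:
  assumes "ratio_less m u v"
  shows "ratio_less m (\<lambda>i. \<Sum>j\<le>i. u j) (\<lambda>i. \<Sum>j\<le>i. v j)"
  unfolding ratio_less_def
proof (intro allI impI)
  fix k l :: nat
  assume kl: "k < l" "l \<le> m"
  have split: "(\<Sum>j\<le>l. w j) = (\<Sum>j\<le>k. w j) + (\<Sum>j\<in>{k<..l}. w j)" for w :: "nat \<Rightarrow> real"
  proof -
    have "{..l} = {..k} \<union> {k<..l}" using kl by auto
    then show ?thesis by (simp add: sum.union_disjoint ivl_disj_int)
  qed
  have "(\<Sum>j\<in>{k<..l}. u j) * (\<Sum>j\<le>k. v j) = (\<Sum>a\<in>{k<..l}. \<Sum>b\<le>k. u a * v b)"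
    by (simp add: sum_product)
  also have "\<dots> < (\<Sum>a\<in>{k<..l}. \<Sum>b\<le>k. u b * v a)"
    using kl assms by (intro sum_strict_mono) (auto simp: ratio_less_def)
  also have "\<dots> = (\<Sum>j\<le>k. u j) * (\<Sum>j\<in>{k<..l}. v j)"
    unfolding sum_product by (rule sum.swap)
  finally show "(\<Sum>j\<le>l. u j) * (\<Sum>j\<le>k. v j) < (\<Sum>j\<le>k. u j) * (\<Sum>j\<le>l. v j)"
    unfolding split by (simp add: algebra_simps)
qed

text \<open>The vector of \<open>x > 1\<close> consists of the prefix sums of the positive vector of \<open>x - 1\<close>.\<close>

lemma rat_vec_strict_mono_index:
  assumes "x \<in> \<rat>" and "1 < x" and "k < l" and "l \<le> m"
  shows "rat_vec m x k < rat_vec m x l"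
proof -
  have "rat_vec m x i = (\<Sum>j\<le>i. rat_vec m (x - 1) j)" for i
    using rat_vec_add_1[of "x - 1" m i] assms by simp
  moreover have "(\<Sum>j\<le>k. rat_vec m (x - 1) j) < (\<Sum>j\<le>l. rat_vec m (x - 1) j)"
    by (rule sum_strict_mono2[of _ _ l])
      (use assms rat_vec_pos[of "x - 1" _ m] in \<open>auto simp: less_imp_le\<close>)
  ultimately show ?thesis by simp
qed

lemma rat_vec_strict_antimono_index:
  assumes "x \<in> \<rat>" and "0 < x" and "x < 1" and "k < l" and "l \<le> m"
  shows "rat_vec m x l < rat_vec m x k"
  using rat_vec_strict_mono_index[of "1 / x" "m - l" "m - k" m]
    rat_vec_inverse[of x "m - l" m] rat_vec_inverse[of x "m - k" m] assms by simp

text \<open>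
  The base of the induction: the two vectors are monotone in opposite directions, at least one of
  them strictly, because \<open>x\<close> and \<open>y\<close> cannot both be 1.
\<close>

lemma ratio_less_separated_by_1:
  assumes x: "x \<in> \<rat>" "0 < x" "x \<le> 1" and y: "y \<in> \<rat>" "1 \<le> y" and "x < y"
  shows "ratio_less m (rat_vec m x) (rat_vec m y)"
  unfolding ratio_less_def
proof (intro allI impI)
  fix k l assume kl: "k < l" "l \<le> m"
  have pos: "0 < rat_vec m x l" "0 < rat_vec m y k" "0 < rat_vec m x k" "0 < rat_vec m y l"
    using assms kl by (auto intro!: rat_vec_pos)
  have yle: "rat_vec m y k \<le> rat_vec m y l"
    using y kl rat_vec_strict_mono_index[of y k l m] by (cases "y = 1") (auto simp: rat_vec_1)
  have xle: "rat_vec m x l \<le> rat_vec m x k"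
    using x kl rat_vec_strict_antimono_index[of x k l m] by (cases "x = 1") (auto simp: rat_vec_1)
  show "rat_vec m x l * rat_vec m y k < rat_vec m x k * rat_vec m y l"
  proof (cases "x < 1")
    case True
    with x kl have "rat_vec m x l < rat_vec m x k" by (intro rat_vec_strict_antimono_index)
    then show ?thesis using yle pos by (intro mult_less_le_imp_less) auto
  next
    case False
    with assms have "1 < y" by simp
    with y kl have "rat_vec m y k < rat_vec m y l" by (intro rat_vec_strict_mono_index)
    then show ?thesis using xle pos by (intro mult_le_less_imp_less) auto
  qed
qed

lemma ratio_less_cong:
  assumes "ratio_less m u v" and "\<And>i. i \<le> m \<Longrightarrow> u i = u' i" and "\<And>i. i \<le> m \<Longrightarrow> v i = v' i"
  shows "ratio_less m u' v'"
  using assms unfolding ratio_less_def by (metis less_imp_le order.trans)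

lemma ratio_less_rat_vec_add_1:
  assumes "x \<in> \<rat>" "0 < x" "y \<in> \<rat>" "0 < y" and "ratio_less m (rat_vec m x) (rat_vec m y)"
  shows "ratio_less m (rat_vec m (x + 1)) (rat_vec m (y + 1))"
  using ratio_less_prefix_sums[OF assms(5)]
  by (rule ratio_less_cong) (use assms in \<open>auto simp: rat_vec_add_1\<close>)

lemma ratio_less_rat_vec_inverse:
  assumes "x \<in> \<rat>" "0 < x" "y \<in> \<rat>" "0 < y" and "ratio_less m (rat_vec m x) (rat_vec m y)"
  shows "ratio_less m (rat_vec m (1 / y)) (rat_vec m (1 / x))"
  using ratio_less_reverse[OF assms(5)]
  by (rule ratio_less_cong) (use assms in \<open>auto simp: rat_vec_inverse\<close>)

lemma ratio_less_rat_vec: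
  assumes "x \<in> \<rat>" "0 < x" "y \<in> \<rat>" "x < y"
  shows "ratio_less m (rat_vec m x) (rat_vec m y)"
proof -
  let ?L = "\<lambda>x y. ratio_less m (rat_vec m x) (rat_vec m y)"
  \<comment> \<open>Both orders of \<open>x\<close> and \<open>y\<close> are needed at once, since inversion exchanges them.\<close>
  from assms(1,2) have "\<forall>y\<in>\<rat>. 0 < y \<longrightarrow> (x < y \<longrightarrow> ?L x y) \<and> (y < x \<longrightarrow> ?L y x)"
  proof (induction rule: rational_pos_induct)
    case one
    show ?case by (auto intro!: ratio_less_separated_by_1)
  next
    case (add_1 x)
    show ?case
    proof (intro ballI impI)
      fix y :: real assume y: "y \<in> \<rat>" "0 < y"
      show "(x + 1 < y \<longrightarrow> ?L (x + 1) y) \<and> (y < x + 1 \<longrightarrow> ?L y (x + 1))"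
      proof (cases "y \<le> 1")
        case True
        with y add_1.hyps show ?thesis by (auto intro!: ratio_less_separated_by_1)
      next
        case False
        with y have y': "y - 1 \<in> \<rat>" "0 < y - 1" by auto
        with add_1.IH have "x < y - 1 \<longrightarrow> ?L x (y - 1)" "y - 1 < x \<longrightarrow> ?L (y - 1) x" by auto
        with y' add_1.hyps ratio_less_rat_vec_add_1[of x "y - 1" m]
          ratio_less_rat_vec_add_1[of "y - 1" x m]
        show ?thesis by auto
      qed
    qed
  next
    case (inverse x)
    show ?case
    proof (intro ballI impI)
      fix y :: real assume y: "y \<in> \<rat>" "0 < y"
      then have y': "1 / y \<in> \<rat>" "0 < 1 / y" by auto
      have "1 / x < y \<longleftrightarrow> 1 / y < x" "y < 1 / x \<longleftrightarrow> x < 1 / y"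
        using y inverse.hyps by (auto simp: field_simps)
      moreover have "x < 1 / y \<longrightarrow> ?L x (1 / y)" "1 / y < x \<longrightarrow> ?L (1 / y) x"
        using inverse.IH y' by auto
      ultimately show "(1 / x < y \<longrightarrow> ?L (1 / x) y) \<and> (y < 1 / x \<longrightarrow> ?L y (1 / x))"
        using y y' inverse.hyps ratio_less_rat_vec_inverse[of x "1 / y" m]
          ratio_less_rat_vec_inverse[of "1 / y" x m] by auto
    qed
  qed
  then show ?thesis using assms by auto
qed

lemma higher_cf_rat_strict_mono:
  assumes "x \<in> \<rat>" "0 \<le> x" "y \<in> \<rat>" "x < y" and i: "0 < i" "i \<le> m"
  shows "higher_cf_rat i m x < higher_cf_rat i m y"
proof -
  have y: "0 < rat_vec m y i" "0 < rat_vec m y 0" using assms by (auto intro!: rat_vec_pos)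
  show ?thesis
  proof (cases "x = 0")
    case True
    then show ?thesis using y i by (simp add: higher_cf_rat_eq rat_vec_0)
  next
    case False
    with assms have "0 < x" by simp
    with assms have "0 < rat_vec m x 0" by (auto intro!: rat_vec_pos)
    moreover have "rat_vec m x i * rat_vec m y 0 < rat_vec m x 0 * rat_vec m y i"
      using ratio_less_rat_vec[of x y m] assms \<open>0 < x\<close> by (auto simp: ratio_less_def)
    ultimately show ?thesis using y i by (simp add: higher_cf_rat_eq field_simps)
  qed
qed


section \<open>Truncated expansions\<close>

text \<open>
  The value 1 is singled out because it is the only one for which a preceding partial quotient is not
  the floor of the number: the truncated expansion then ends in 1 and is not the canonical one.
\<close>

lemma cfrac_value_pos_tail:
  assumes "cs \<noteq> []" and "\<forall>c\<in>set cs. 1 \<le> c"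
  shows "cfrac_value cs \<in> \<rat> \<and> 1 \<le> cfrac_value cs \<and> (cfrac_value cs = 1 \<longrightarrow> cs = [1])"
  using assms
proof (induction cs rule: cfrac_value.induct)
  case (3 c d cs)
  then have "1 \<le> cfrac_value (d # cs)" "cfrac_value (d # cs) \<in> \<rat>" by auto
  moreover from this have "0 < 1 / cfrac_value (d # cs)" by simp
  moreover have "1 \<le> real_of_int c" using 3 by simp
  ultimately have "1 < real_of_int c + 1 / cfrac_value (d # cs)" by linarith
  then show ?case using \<open>cfrac_value (d # cs) \<in> \<rat>\<close> by simp
qed auto

lemma cfrac_value_Rats_nonneg:
  assumes "0 \<le> c" and "\<forall>d\<in>set cs. 1 \<le> d"
  shows "cfrac_value (c # cs) \<in> \<rat> \<and> 0 \<le> cfrac_value (c # cs)"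
proof (cases cs)
  case (Cons d ds)
  then show ?thesis using cfrac_value_pos_tail[of cs] assms by simp
qed (use assms in simp)

text \<open>
  Both expansions of a rational number have the same vector: \<open>\<Lambda>\<^sub>m(1)\<close> sends the last unit vector to
  the constant vector 1, to which \<open>c\<close> prefix sums are applied, and \<open>\<Lambda>\<^sub>m(c + 1)\<close> applies \<open>c + 1\<close>
  prefix sums to the first unit vector, the first of which gives the same constant vector.
\<close>

lemma rat_vec_cfrac_value:
  assumes "0 \<le> c" and "\<forall>d\<in>set cs. 1 \<le> d" and "i \<le> m"
  shows "rat_vec m (cfrac_value (c # cs)) i = cf_vec m (c # cs) i"
  using assms
proof (induction cs arbitrary: c i)
  case Nil
  then show ?case using rat_vec_of_int[of m c] by (simp add: cf_vec_Cons)
next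
  case (Cons d ds)
  define y where "y = cfrac_value (d # ds)"
  have y: "y \<in> \<rat>" "1 \<le> y" "y = 1 \<longrightarrow> d # ds = [1]"
    using cfrac_value_pos_tail[of "d # ds"] Cons.prems by (auto simp: y_def)
  have x: "cfrac_value (c # d # ds) = of_int c + 1 / y" by (simp add: y_def)
  have IH: "rat_vec m y j = cf_vec m (d # ds) j" if "j \<le> m" for j
    using Cons.IH[of d j] Cons.prems that by (simp add: y_def)
  show ?case
  proof (cases "y = 1")
    case True
    then have "rat_vec m (cfrac_value (c # d # ds)) i = rat_vec m (of_int (c + 1)) i"
      unfolding x by simp
    also have "\<dots> = (\<Sum>j\<le>i. cf_step m c (cf_vec m []) j)"
      unfolding rat_vec_of_int by (rule cf_step_add_1)
    also have "\<dots> = (\<Sum>j\<le>i. multichoose c (int j))"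
    proof (intro sum.cong refl)
      fix j assume "j \<in> {..i}"
      then have "cf_step m c (cf_vec m []) j = (\<Sum>t\<le>j. if t = 0 then multichoose c (int j) else 0)"
        using Cons.prems(3) unfolding cf_step_def cf_vec_Nil by (intro sum.cong) auto
      then show "cf_step m c (cf_vec m []) j = multichoose c (int j)" by simp
    qed
    also have "\<dots> = (\<Sum>j\<le>i. multichoose c (int (i - j)))"
      unfolding atMost_atLeast0 by (rule trans[OF sum.atLeastAtMost_rev]) simp
    also have "\<dots> = cf_vec m (c # d # ds) i"
      using IH True Cons.prems by (simp add: cf_vec_Cons[of m c] cf_step_def rat_vec_1)
    finally show ?thesis .
  next
    case False
    with y have "1 < y" by simp
    then have fr: "0 < 1 / y" "1 / y < 1" by auto
    then have fl: "\<lfloor>of_int c + 1 / y\<rfloor> = c" by (simp add: floor_eq_iff)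
    then have fr': "frac (of_int c + 1 / y) = 1 / y" by (simp add: frac_def)
    then have "of_int c + 1 / y \<notin> \<int>" using fr by (metis frac_eq_0_iff less_irrefl)
    then have "rat_vec m (of_int c + 1 / y) = cf_step m c (rat_vec m y)"
      using rat_vec_not_Ints[of "of_int c + 1 / y" m] Cons.prems y fl fr fr' by simp
    then show ?thesis
      unfolding x cf_vec_Cons[of m c] using cf_step_cong[of m "rat_vec m y"] IH by simp
  qed
qed


section \<open>Projective contraction\<close>

text \<open>
  This is closeness of the rays spanned by \<open>u\<close> and \<open>v\<close>: the projective (Hilbert) distance is at
  most \<open>ln (1 + e)\<close>.
\<close>

definition proportional_within :: "nat \<Rightarrow> real \<Rightarrow> (nat \<Rightarrow> real) \<Rightarrow> (nat \<Rightarrow> real) \<Rightarrow> bool" where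
  "proportional_within m e u v \<longleftrightarrow>
     (\<exists>s>0. \<forall>i\<le>m. s * v i \<le> u i \<and> u i \<le> s * (1 + e) * v i)"

text \<open>
  Up to a factor of at most \<open>m + 1\<close>, two steps send \<open>u\<close> to a multiple of a vector that is
  independent of \<open>u\<close>, with a coefficient linear in \<open>u\<close>. The reason is that the inner step yields an
  increasing vector and the coefficients of the outer one increase as well, so among the at most
  \<open>m + 1\<close> summands of a coordinate the first is the largest. The factor does not depend on \<open>a\<close> and
  \<open>b\<close>, which makes the contraction uniform over unbounded partial quotients.
\<close>

lemma two_steps_bounds:
  assumes "1 \<le> a" "1 \<le> b" "\<And>i. i \<le> m \<Longrightarrow> 0 \<le> u i" "i \<le> m"
  defines "y \<equiv> cf_step m b u"
  shows "multichoose a (int i) * y m \<le> cf_step m a y i"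
    and "cf_step m a y i \<le> real (m + 1) * (multichoose a (int i) * y m)"
proof -
  have y0: "0 \<le> y j" for j unfolding y_def using assms by (intro cf_step_nonneg) auto
  have ym: "y j \<le> y m" if "j \<le> m" for j
    unfolding y_def using assms that by (intro cf_step_mono_index) auto
  have h0: "0 \<le> multichoose a (int i)" using assms multichoose_nonneg by simp
  show "multichoose a (int i) * y m \<le> cf_step m a y i"
    using assms y0 by (intro cf_step_ge_first) auto
  have "cf_step m a y i \<le> (\<Sum>j\<le>i. multichoose a (int i) * y m)"
    unfolding cf_step_def
    using assms y0 ym h0 by (intro sum_mono mult_mono multichoose_mono) auto
  also have "\<dots> = real (i + 1) * (multichoose a (int i) * y m)" by simp
  also have "\<dots> \<le> real (m + 1) * (multichoose a (int i) * y m)"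
    using assms y0 h0 by (intro mult_right_mono mult_nonneg_nonneg) auto
  finally show "cf_step m a y i \<le> real (m + 1) * (multichoose a (int i) * y m)" .
qed

text \<open>
  Two steps bring any two admissible vectors within a bounded projective distance, even if zero
  entries made their own distance infinite.
\<close>

lemma two_steps_start:
  assumes "1 \<le> a" "1 \<le> b" and u: "admissible m u" and v: "admissible m v"
  shows "proportional_within m (real (m + 1) ^ 2)
           (cf_step m a (cf_step m b u)) (cf_step m a (cf_step m b v))"
proof -
  define K where "K = real (m + 1)"
  define p q where "p = cf_step m b u m" and "q = cf_step m b v m"
  have K: "1 \<le> K" by (simp add: K_def)
  have pq: "0 < p" "0 < q" unfolding p_def q_def using assms by (auto intro!: cf_step_pos)
  define s where "s = p / (K * q)"
  have s: "0 < s" using pq K by (simp add: s_def)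
  have "s * cf_step m a (cf_step m b v) i \<le> cf_step m a (cf_step m b u) i \<and>
        cf_step m a (cf_step m b u) i \<le> s * (1 + K ^ 2) * cf_step m a (cf_step m b v) i"
    if i: "i \<le> m" for i
  proof -
    define h U V where "h = multichoose a (int i)" and "U = cf_step m a (cf_step m b u) i"
      and "V = cf_step m a (cf_step m b v) i"
    have U: "h * p \<le> U" "U \<le> K * (h * p)"
      unfolding h_def p_def U_def K_def
      using two_steps_bounds[of a b m u i] assms i by (auto simp: admissible_def)
    have V: "h * q \<le> V" "V \<le> K * (h * q)"
      unfolding h_def q_def V_def K_def
      using two_steps_bounds[of a b m v i] assms i by (auto simp: admissible_def)
    have V0: "0 \<le> V" unfolding V_def using assms by (auto simp: admissible_def intro!: cf_step_nonneg)
    have "s * V \<le> s * (K * (h * q))" using V s by (intro mult_left_mono) auto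
    also have "\<dots> = h * p" using K pq by (simp add: s_def)
    also have "\<dots> \<le> U" by (rule U)
    finally have 1: "s * V \<le> U" .
    have "U \<le> K * (h * p)" by (rule U)
    also have "\<dots> = s * K ^ 2 * (h * q)"
      using K pq by (simp add: s_def power2_eq_square)
    also have "\<dots> \<le> s * K ^ 2 * V" using V s by (intro mult_left_mono) auto
    also have "\<dots> \<le> s * (1 + K ^ 2) * V" using V0 s by (intro mult_right_mono) auto
    finally show ?thesis using 1 by (simp add: U_def V_def)
  qed
  then show ?thesis unfolding proportional_within_def K_def using s by blast
qed

text \<open>
  The vectors \<open>u - s v\<close> and \<open>s (1 + e) v - u\<close> are nonnegative, and by \<open>two_steps_bounds\<close> their
  images dominate multiples of the image of \<open>v\<close>. The lower and the upper proportionality constant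
  therefore move towards each other, together by the fraction \<open>1 / (m + 1)\<close> of their distance.
\<close>

lemma two_steps_contract:
  assumes "1 \<le> a" "1 \<le> b" and u: "admissible m u" and v: "admissible m v"
    and "0 \<le> e" and near: "proportional_within m e u v"
  shows "proportional_within m (e * (1 - 1 / real (m + 1)))
           (cf_step m a (cf_step m b u)) (cf_step m a (cf_step m b v))"
proof -
  define K where "K = real (m + 1)"
  define P where "P = (\<lambda>w. cf_step m a (cf_step m b w))"
  define f where "f = (\<lambda>w. cf_step m b w m)"
  have K: "1 \<le> K" by (simp add: K_def)
  obtain s where s: "0 < s" and lower: "\<And>i. i \<le> m \<Longrightarrow> s * v i \<le> u i"
    and upper: "\<And>i. i \<le> m \<Longrightarrow> u i \<le> s * (1 + e) * v i"
    using near unfolding proportional_within_def by blast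
  have P_diff: "P (\<lambda>i. x * w i - y * z i) i = x * P w i - y * P z i" for x y w z i
    unfolding P_def cf_step_diff[abs_def] ..
  have f_diff: "f (\<lambda>i. x * w i - y * z i) = x * f w - y * f z" for x y w z
    unfolding f_def cf_step_diff[abs_def] ..
  have fv: "0 < f v" unfolding f_def using assms by (intro cf_step_pos)
  have gain: "f w / (K * f v) * P v i \<le> P w i" if w: "\<And>i. i \<le> m \<Longrightarrow> 0 \<le> w i" and i: "i \<le> m" for w i
  proof -
    define h where "h = multichoose a (int i)"
    have fw: "0 \<le> f w" unfolding f_def using assms w by (intro cf_step_nonneg) auto
    have "f w / (K * f v) * P v i \<le> f w / (K * f v) * (K * (h * f v))"
      using two_steps_bounds(2)[of a b m v i] assms i fw fv K
      by (intro mult_left_mono) (auto simp: admissible_def P_def f_def h_def K_def)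
    also have "\<dots> = h * f w" using K fv by simp
    also have "\<dots> \<le> P w i"
      using two_steps_bounds(1)[of a b m w i] assms i w by (simp add: P_def f_def h_def)
    finally show ?thesis .
  qed
  \<comment> \<open>The amounts by which the lower constant rises and the upper one falls.\<close>
  define d1 where "d1 = (f u - s * f v) / (K * f v)"
  define d2 where "d2 = (s * (1 + e) * f v - f u) / (K * f v)"
  have d: "d1 + d2 = s * e / K"
    unfolding d1_def d2_def using fv K by (simp add: field_simps)
  have d1: "0 \<le> d1"
  proof -
    have "0 \<le> f (\<lambda>i. 1 * u i - s * v i)"
      unfolding f_def using lower assms by (intro cf_step_nonneg) auto
    then have "0 \<le> f u - s * f v" unfolding f_diff by simp
    then show ?thesis using fv K by (simp add: d1_def)
  qed
  have lower': "(s + d1) * P v i \<le> P u i" if "i \<le> m" for i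
    using gain[of "\<lambda>i. 1 * u i - s * v i" i] lower that
    unfolding P_diff f_diff by (simp add: d1_def algebra_simps)
  have upper': "P u i \<le> (s * (1 + e) - d2) * P v i" if "i \<le> m" for i
    using gain[of "\<lambda>i. s * (1 + e) * v i - 1 * u i" i] upper that
    unfolding P_diff f_diff by (simp add: d2_def algebra_simps)
  have "s * (1 + e) - d2 = (s + d1) + s * (e * (1 - 1 / K))"
    using d K by (simp add: field_simps)
  also have "\<dots> \<le> (s + d1) + (s + d1) * (e * (1 - 1 / K))"
    using d1 assms(5) K by (intro add_left_mono mult_right_mono) auto
  also have "\<dots> = (s + d1) * (1 + e * (1 - 1 / K))" by (simp add: algebra_simps)
  finally have c: "s * (1 + e) - d2 \<le> (s + d1) * (1 + e * (1 - 1 / K))" .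
  have "P u i \<le> (s + d1) * (1 + e * (1 - 1 / K)) * P v i" if "i \<le> m" for i
  proof -
    have "0 \<le> P v i"
      unfolding P_def using assms by (auto simp: admissible_def intro!: cf_step_nonneg)
    then show ?thesis using upper'[OF that] mult_right_mono[OF c] by (meson order_trans)
  qed
  then show ?thesis
    unfolding proportional_within_def using lower' s d1
    by (intro exI[of _ "s + d1"]) (auto simp: P_def K_def)
qed

text \<open>A bound for \<open>e\<close> in \<open>proportional_within\<close> after one initial pair of steps and \<open>k\<close> contracting ones.\<close>

definition contraction_error :: "nat \<Rightarrow> nat \<Rightarrow> real" where
  "contraction_error m k = real (m + 1) ^ 2 * (1 - 1 / real (m + 1)) ^ k"

lemma contraction_error_nonneg: "0 \<le> contraction_error m k"
  by (simp add: contraction_error_def)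

lemma contraction_error_tendsto_0: "contraction_error m \<longlonglongrightarrow> 0"
proof -
  have "(\<lambda>k. (1 - 1 / real (m + 1)) ^ k) \<longlonglongrightarrow> 0"
    by (rule LIMSEQ_realpow_zero) (auto simp: field_simps)
  then show ?thesis
    unfolding contraction_error_def[abs_def] by (rule tendsto_mult_right_zero)
qed

lemma foldr_cf_step_contract:
  assumes "length cs = 2 * k + 2" "\<forall>c\<in>set cs. 1 \<le> c" "admissible m u" "admissible m v"
  shows "proportional_within m (contraction_error m k)
           (foldr (cf_step m) cs u) (foldr (cf_step m) cs v)"
  using assms(1,2)
proof (induction k arbitrary: cs)
  case 0
  then obtain a b where "cs = [a, b]" by (auto simp: length_Suc_conv numeral_2_eq_2)
  then show ?case
    using two_steps_start[of a b m u v] 0 assms by (simp add: contraction_error_def)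
next
  case (Suc k)
  then obtain a b ds where cs: "cs = a # b # ds" "length ds = 2 * k + 2"
    by (auto simp: length_Suc_conv)
  then have "proportional_within m (contraction_error m k)
      (foldr (cf_step m) ds u) (foldr (cf_step m) ds v)"
    using Suc by simp
  then show ?case
    using two_steps_contract[of a b m "foldr (cf_step m) ds u" "foldr (cf_step m) ds v"
        "contraction_error m k"] Suc.prems cs assms(3,4) contraction_error_nonneg
      admissible_foldr[of ds m u] admissible_foldr[of ds m v]
    by (simp add: contraction_error_def mult_ac)
qed

lemma proportional_within_cf_step:
  assumes "0 \<le> c" and "proportional_within m e u v"
  shows "proportional_within m e (cf_step m c u) (cf_step m c v)"
proof -
  obtain s where s: "0 < s" "\<And>i. i \<le> m \<Longrightarrow> s * v i \<le> u i" "\<And>i. i \<le> m \<Longrightarrow> u i \<le> s * (1 + e) * v i"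
    using assms(2) unfolding proportional_within_def by blast
  have scale: "cf_step m c (\<lambda>i. t * v i) i = t * cf_step m c v i" for t i
    using cf_step_diff[of m c t v 0 v i] by simp
  have "s * cf_step m c v i \<le> cf_step m c u i \<and> cf_step m c u i \<le> s * (1 + e) * cf_step m c v i" for i
    unfolding scale[symmetric] using assms(1) s by (auto intro!: cf_step_mono_vec)
  then show ?thesis unfolding proportional_within_def using s(1) by blast
qed

lemma proportional_within_ratio_le:
  assumes "proportional_within m e u v" "i \<le> m" "0 < u 0" "0 < v 0" "0 \<le> u i" "0 \<le> v i" "0 \<le> e"
  shows "u i / u 0 \<le> (1 + e) * (v i / v 0)"
proof -
  obtain s where s: "0 < s" "s * v 0 \<le> u 0" "u i \<le> s * (1 + e) * v i"
    using assms(1,2) unfolding proportional_within_def by blast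
  have "u i / u 0 \<le> (s * (1 + e) * v i) / (s * v 0)"
    using assms s by (intro frac_le) auto
  also have "\<dots> = (1 + e) * (v i / v 0)" using s by simp
  finally show ?thesis .
qed


section \<open>Irrational arguments\<close>

lemma irrational_step:
  assumes "x \<notin> \<rat>"
  shows "1 / frac x \<notin> \<rat>" and "1 < 1 / frac x"
proof -
  have "frac x \<noteq> 0" using assms by (metis Ints_subset_Rats frac_eq_0_iff subsetD)
  then have f: "0 < frac x" "frac x < 1" using frac_ge_0[of x] frac_lt_1[of x] by auto
  then show "1 < 1 / frac x" by simp
  have "frac x \<notin> \<rat>"
    using assms unfolding frac_def by (metis Rats_add Rats_of_int diff_add_cancel)
  then show "1 / frac x \<notin> \<rat>"
    by (metis Rats_1 Rats_divide divide_divide_eq_right div_by_1 mult_1)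
qed

lemma cfrac_take_irrational_ge_1:
  "x \<notin> \<rat> \<Longrightarrow> 1 < x \<Longrightarrow> \<forall>c\<in>set (cfrac_take n x). 1 \<le> c"
proof (induction n arbitrary: x)
  case 0
  then show ?case by (simp add: cfrac_take_def)
next
  case (Suc n)
  then show ?case using irrational_step[of x] by (simp add: cfrac_take_Suc)
qed

lemma complete_quotient_irrational:
  "x \<notin> \<rat> \<Longrightarrow> 1 < x \<Longrightarrow> 1 < complete_quotient x n"
proof (induction n arbitrary: x)
  case (Suc n)
  then show ?case using irrational_step[of x] by (simp add: complete_quotient_Suc_shift del: complete_quotient.simps)
qed simp

lemma length_cfrac_take: "length (cfrac_take n x) = n"
  by (simp add: cfrac_take_def)

lemma cfrac_take_append:
  assumes "k \<le> n"
  shows "\<exists>ds. cfrac_take n x = cfrac_take k x @ ds"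
proof -
  have "[0..<n] = [0..<k] @ [k..<n]" using assms by (metis le_add_diff_inverse upt_add_eq_append zero_le)
  then show ?thesis unfolding cfrac_take_def by auto
qed

lemma truncation_vec_pos:
  assumes "x \<notin> \<rat>" "0 \<le> x" "admissible m u"
  shows "0 < foldr (cf_step m) (cfrac_take (Suc n) x) u 0"
    and "0 \<le> foldr (cf_step m) (cfrac_take (Suc n) x) u i"
proof -
  let ?t = "foldr (cf_step m) (cfrac_take n (1 / frac x)) u"
  have adm: "admissible m ?t"
    using assms irrational_step[of x] by (intro admissible_foldr cfrac_take_irrational_ge_1)
  have eq: "foldr (cf_step m) (cfrac_take (Suc n) x) u = cf_step m \<lfloor>x\<rfloor> ?t"
    by (simp add: cfrac_take_Suc)
  show "0 < foldr (cf_step m) (cfrac_take (Suc n) x) u 0"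
    unfolding eq using adm by (simp add: admissible_def)
  show "0 \<le> foldr (cf_step m) (cfrac_take (Suc n) x) u i"
    unfolding eq using adm assms by (intro cf_step_nonneg) (auto simp: admissible_def)
qed

text \<open>
  The terminal vectors \<open>u\<close> and \<open>v\<close> are arbitrary in order to cover both the last unit vector, which
  gives the convergents, and for \<open>m = 1\<close> the vector \<open>(1, y)\<close> with the complete quotient \<open>y\<close>, which
  gives \<open>x\<close> itself. The first partial quotient may be 0, hence it is split off from the contracting
  pairs.
\<close>

lemma truncation_ratio_le:
  fixes x :: real
  assumes x: "x \<notin> \<rat>" "0 \<le> x" and "2 * k + 2 \<le> n" "2 * k + 2 \<le> n'"
    and adm: "admissible m u" "admissible m v" and "i \<le> m"
  defines "U \<equiv> foldr (cf_step m) (cfrac_take (Suc n) x) u"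
    and "V \<equiv> foldr (cf_step m) (cfrac_take (Suc n') x) v"
  shows "U i / U 0 \<le> (1 + contraction_error m k) * (V i / V 0)"
proof -
  let ?z = "1 / frac x"
  have ge1: "\<forall>c\<in>set (cfrac_take n ?z). 1 \<le> c" for n
    using x irrational_step[of x] by (intro cfrac_take_irrational_ge_1)
  obtain ds ds' where ds: "cfrac_take n ?z = cfrac_take (2 * k + 2) ?z @ ds"
      "cfrac_take n' ?z = cfrac_take (2 * k + 2) ?z @ ds'"
    using cfrac_take_append assms(3,4) by metis
  then have ge1': "\<forall>c\<in>set ds. 1 \<le> c" "\<forall>c\<in>set ds'. 1 \<le> c"
    using ge1[of n] ge1[of n'] by auto
  have "proportional_within m (contraction_error m k)
      (foldr (cf_step m) (cfrac_take n ?z) u) (foldr (cf_step m) (cfrac_take n' ?z) v)"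
    unfolding ds foldr_append
    using ge1[of "2 * k + 2"] ge1' adm
    by (intro foldr_cf_step_contract admissible_foldr) (auto simp: length_cfrac_take)
  then have "proportional_within m (contraction_error m k) U V"
    unfolding U_def V_def cfrac_take_Suc
    using proportional_within_cf_step[of "\<lfloor>x\<rfloor>"] x by simp
  then show ?thesis
    using truncation_vec_pos x adm contraction_error_nonneg assms(7)
    unfolding U_def V_def by (intro proportional_within_ratio_le) auto
qed

lemma higher_cf_rat_convergent_eq:
  assumes "x \<notin> \<rat>" "0 \<le> x" "i \<le> m"
  shows "higher_cf_rat i m (cfrac_value (cfrac_take (Suc n) x))
    = cf_vec m (cfrac_take (Suc n) x) i / cf_vec m (cfrac_take (Suc n) x) 0"
proof -
  have "\<forall>c\<in>set (cfrac_take n (1 / frac x)). 1 \<le> c"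
    using assms irrational_step[of x] by (intro cfrac_take_irrational_ge_1)
  then show ?thesis
    using assms by (simp add: higher_cf_rat_eq cfrac_take_Suc rat_vec_cfrac_value)
qed

text \<open>The relative bounds make the sequence bounded, so they become absolute ones.\<close>

lemma convergent_of_ratio_le:
  fixes f :: "nat \<Rightarrow> real"
  assumes e: "e \<longlonglongrightarrow> 0" "\<And>k. 0 \<le> e k" and "\<And>n. 0 \<le> f n"
    and le: "\<And>k n n'. N k \<le> n \<Longrightarrow> N k \<le> n' \<Longrightarrow> f n \<le> (1 + e k) * f n'"
  shows "convergent f"
proof -
  define R where "R = (1 + e 0) * f (N 0)"
  have R: "f n \<le> R" if "N 0 \<le> n" for n
    using le[of 0 n "N 0"] that by (simp add: R_def)
  have "Cauchy f"
  proof (rule CauchyI)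
    fix d :: real assume d: "0 < d"
    have "(\<lambda>k. e k * R) \<longlonglongrightarrow> 0" using e(1) by (rule tendsto_mult_left_zero)
    then have "eventually (\<lambda>k. e k * R < d) sequentially" using d by (rule order_tendstoD)
    then obtain k where k: "e k * R < d" by (auto simp: eventually_sequentially)
    have *: "f n - f n' < d" if "max (N 0) (N k) \<le> n" "max (N 0) (N k) \<le> n'" for n n'
    proof -
      have "f n - f n' \<le> e k * f n'" using le[of k n n'] that by (simp add: algebra_simps)
      also have "\<dots> \<le> e k * R" using R[of n'] e(2) that by (intro mult_left_mono) auto
      finally show ?thesis using k by simp
    qed
    show "\<exists>M. \<forall>n\<ge>M. \<forall>n'\<ge>M. norm (f n - f n') < d"
    proof (intro exI allI impI)
      fix n n' assume "max (N 0) (N k) \<le> n" "max (N 0) (N k) \<le> n'"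
      from *[OF this] *[OF this(2,1)] show "norm (f n - f n') < d" by (simp add: abs_less_iff)
    qed
  qed
  then show ?thesis by (rule Cauchy_convergent)
qed

lemma higher_cf_irrational_LIMSEQ:
  assumes "x \<notin> \<rat>" "0 \<le> x" "i \<le> m"
  shows "(\<lambda>n. higher_cf_rat i m (cfrac_value (cfrac_take (Suc n) x))) \<longlonglongrightarrow> higher_cf i m x"
proof -
  let ?f = "\<lambda>n. cf_vec m (cfrac_take (Suc n) x) i / cf_vec m (cfrac_take (Suc n) x) 0"
  have "convergent ?f"
  proof (rule convergent_of_ratio_le[where e = "contraction_error m" and N = "\<lambda>k. 2 * k + 2"])
    show "contraction_error m \<longlonglongrightarrow> 0" by (rule contraction_error_tendsto_0)
    show "0 \<le> contraction_error m k" for k by (rule contraction_error_nonneg)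
    show "0 \<le> ?f n" for n
      unfolding cf_vec_def using truncation_vec_pos[OF assms(1,2) admissible_seed, where n = n]
      by (simp add: less_imp_le)
    show "?f n \<le> (1 + contraction_error m k) * ?f n'" if "2 * k + 2 \<le> n" "2 * k + 2 \<le> n'" for k n n'
      unfolding cf_vec_def
      using assms that admissible_seed by (intro truncation_ratio_le) auto
  qed
  then show ?thesis
    using assms by (simp add: higher_cf_def higher_cf_rat_convergent_eq convergent_LIMSEQ_iff)
qed

lemma cf_step_1: "cf_step 1 c w 0 = w 1" "cf_step 1 c w 1 = of_int c * w 1 + w 0"
proof -
  have "multichoose c 1 = of_int c" by (simp add: multichoose_def binom_def)
  moreover have "{..1::nat} = {0, 1}" by auto
  ultimately show "cf_step 1 c w 1 = of_int c * w 1 + w 0"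
    unfolding cf_step_def by (simp del: One_nat_def)
qed (simp add: cf_step_def)

text \<open>
  For \<open>m = 1\<close> a step acts on \<open>w\<^sub>1 / w\<^sub>0\<close> as \<open>t \<mapsto> c + 1 / t\<close>. Started at the complete quotient,
  the steps thus undo the expansion exactly.
\<close>

lemma complete_quotient_reconstructs:
  assumes "x \<notin> \<rat>"
  shows "foldr (cf_step 1) (cfrac_take n x) (\<lambda>i. if i = 0 then 1 else complete_quotient x n) 1
    = x * foldr (cf_step 1) (cfrac_take n x) (\<lambda>i. if i = 0 then 1 else complete_quotient x n) 0"
  using assms
proof (induction n arbitrary: x)
  case 0
  then show ?case by (simp add: cfrac_take_def)
next
  case (Suc n)
  define z where "z = 1 / frac x"
  define w where "w = foldr (cf_step 1) (cfrac_take n z)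
    (\<lambda>i. if i = 0 then 1 else complete_quotient z n)"
  have z: "z \<notin> \<rat>" "1 < z" using irrational_step[OF Suc.prems] by (auto simp: z_def)
  have IH: "w 1 = z * w 0" unfolding w_def using Suc.IH[OF z(1)] .
  have "x = of_int \<lfloor>x\<rfloor> + 1 / z" by (simp add: z_def frac_def)
  then have "x * w 1 = of_int \<lfloor>x\<rfloor> * w 1 + w 1 / z" by (metis distrib_right mult_1 times_divide_eq_left)
  also have "w 1 / z = w 0" using IH z(2) by simp
  finally have "cf_step 1 \<lfloor>x\<rfloor> w 1 = x * cf_step 1 \<lfloor>x\<rfloor> w 0" by (simp only: cf_step_1)
  moreover have "foldr (cf_step 1) (cfrac_take (Suc n) x)
      (\<lambda>i. if i = 0 then 1 else complete_quotient x (Suc n)) = cf_step 1 \<lfloor>x\<rfloor> w"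
    unfolding complete_quotient_Suc_shift cfrac_take_Suc w_def z_def by simp
  ultimately show ?case by simp
qed

lemma cfrac_value_eq_ratio:
  assumes "\<forall>d\<in>set cs. 1 \<le> d"
  shows "cfrac_value (c # cs) = cf_vec 1 (c # cs) 1 / cf_vec 1 (c # cs) 0"
  using assms
proof (induction cs arbitrary: c)
  case Nil
  then show ?case by (simp add: cf_vec_Cons cf_step_1 cf_vec_Nil del: One_nat_def)
next
  case (Cons d ds)
  have "admissible 1 (cf_vec 1 (d # ds))"
    unfolding cf_vec_def using Cons.prems by (intro admissible_foldr admissible_seed)
  then have pos: "0 < cf_vec 1 (d # ds) 1" by (simp add: admissible_def)
  have "cfrac_value (d # ds) = cf_vec 1 (d # ds) 1 / cf_vec 1 (d # ds) 0"
    using Cons by simp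
  then show ?case
    unfolding cf_vec_Cons[of 1 c] cf_step_1 using pos by (simp add: field_simps)
qed

text \<open>
  Both \<open>x\<close> and its convergent arise for \<open>m = 1\<close> from the same partial quotients and different
  terminal vectors, so the contraction brings them together.
\<close>

lemma convergents_tendsto:
  assumes "x \<notin> \<rat>" "0 \<le> x"
  shows "(\<lambda>n. cfrac_value (cfrac_take (Suc n) x)) \<longlonglongrightarrow> x"
proof -
  let ?z = "1 / frac x"
  \<comment> \<open>The number of contracting pairs among the \<open>n\<close> partial quotients after the first.\<close>
  define e where "e = (\<lambda>n. contraction_error 1 ((n - 2) div 2))"
  let ?v = "\<lambda>n. cfrac_value (cfrac_take (Suc n) x)"
  have z: "?z \<notin> \<rat>" "1 < ?z" using irrational_step assms by auto
  have bounds: "x / (1 + e n) \<le> ?v n \<and> ?v n \<le> (1 + e n) * x" if n: "2 \<le> n" for n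
  proof -
    let ?k = "(n - 2) div 2"
    define u where "u = (\<lambda>i::nat. if i = 0 then 1 else complete_quotient x (Suc n))"
    let ?T = "foldr (cf_step 1) (cfrac_take (Suc n) x)"
    have adm: "admissible 1 u"
      using complete_quotient_irrational[OF z, of n] unfolding u_def complete_quotient_Suc_shift
      by (auto simp: admissible_def)
    have k: "2 * ?k + 2 \<le> n" using n by presburger
    have "?T u 0 > 0" using truncation_vec_pos[OF assms adm] by blast
    then have x: "?T u 1 / ?T u 0 = x"
      using complete_quotient_reconstructs[OF assms(1), of "Suc n"] by (simp add: u_def)
    have v: "?v n = cf_vec 1 (cfrac_take (Suc n) x) 1 / cf_vec 1 (cfrac_take (Suc n) x) 0"
      unfolding cfrac_take_Suc using cfrac_take_irrational_ge_1[OF z] by (intro cfrac_value_eq_ratio)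
    have "x \<le> (1 + e n) * ?v n" "?v n \<le> (1 + e n) * x"
      using truncation_ratio_le[OF assms k k adm admissible_seed, of 1]
        truncation_ratio_le[OF assms k k admissible_seed adm, of 1]
      unfolding x v cf_vec_def e_def by auto
    then show ?thesis
      using contraction_error_nonneg[of 1 ?k] by (simp add: e_def field_simps)
  qed
  have "e \<longlonglongrightarrow> 0"
  proof -
    have "filterlim (\<lambda>n::nat. (n - 2) div 2) at_top sequentially"
      unfolding filterlim_at_top
    proof
      fix Z :: nat
      show "eventually (\<lambda>n. Z \<le> (n - 2) div 2) sequentially"
        using eventually_ge_at_top[of "2 * Z + 2"] by eventually_elim presburger
    qed
    then show ?thesis
      unfolding e_def by (rule filterlim_compose[OF contraction_error_tendsto_0])
  qed
  then have "(\<lambda>n. x / (1 + e n)) \<longlonglongrightarrow> x / (1 + 0)" "(\<lambda>n. (1 + e n) * x) \<longlonglongrightarrow> (1 + 0) * x"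
    by (intro tendsto_intros; simp)+
  then have "(\<lambda>n. x / (1 + e n)) \<longlonglongrightarrow> x" "(\<lambda>n. (1 + e n) * x) \<longlonglongrightarrow> x" by simp_all
  then show ?thesis
  proof (rule tendsto_sandwich[rotated 2])
    show "eventually (\<lambda>n. x / (1 + e n) \<le> ?v n) sequentially"
      using eventually_ge_at_top[of 2] by eventually_elim (use bounds in blast)
    show "eventually (\<lambda>n. ?v n \<le> (1 + e n) * x) sequentially"
      using eventually_ge_at_top[of 2] by eventually_elim (use bounds in blast)
  qed
qed

lemma higher_cf_rational_bounds:
  assumes "0 \<le> x" "p \<in> \<rat>" "0 \<le> p" "0 < i" "i \<le> m"
  shows "p < x \<Longrightarrow> higher_cf_rat i m p \<le> higher_cf i m x"
    and "x < p \<Longrightarrow> higher_cf i m x \<le> higher_cf_rat i m p"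
proof -
  let ?v = "\<lambda>n. cfrac_value (cfrac_take (Suc n) x)"
  have v: "?v n \<in> \<rat> \<and> 0 \<le> ?v n" if "x \<notin> \<rat>" for n
    unfolding cfrac_take_Suc
    using that assms irrational_step[of x] cfrac_take_irrational_ge_1[of "1 / frac x" n]
    by (intro cfrac_value_Rats_nonneg) auto
  show "higher_cf_rat i m p \<le> higher_cf i m x" if "p < x"
  proof (cases "x \<in> \<rat>")
    case True
    then show ?thesis using higher_cf_rat_strict_mono[of p x i m] assms that by (simp add: higher_cf_def)
  next
    case False
    have "eventually (\<lambda>n. p < ?v n) sequentially"
      using convergents_tendsto[OF False assms(1)] that by (rule order_tendstoD)
    then have "eventually (\<lambda>n. higher_cf_rat i m p \<le> higher_cf_rat i m (?v n)) sequentially"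
      by eventually_elim (use higher_cf_rat_strict_mono assms v[OF False] in \<open>auto simp: less_imp_le\<close>)
    then show ?thesis
      using tendsto_lowerbound higher_cf_irrational_LIMSEQ[OF False assms(1,5)] by force
  qed
  show "higher_cf i m x \<le> higher_cf_rat i m p" if "x < p"
  proof (cases "x \<in> \<rat>")
    case True
    then show ?thesis using higher_cf_rat_strict_mono[of x p i m] assms that by (simp add: higher_cf_def)
  next
    case False
    have "eventually (\<lambda>n. ?v n < p) sequentially"
      using convergents_tendsto[OF False assms(1)] that by (rule order_tendstoD)
    then have "eventually (\<lambda>n. higher_cf_rat i m (?v n) \<le> higher_cf_rat i m p) sequentially"
      by eventually_elim (use higher_cf_rat_strict_mono assms v[OF False] in \<open>auto simp: less_imp_le\<close>)
    then show ?thesis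
      using tendsto_upperbound higher_cf_irrational_LIMSEQ[OF False assms(1,5)] by force
  qed
qed

theorem theorem4:
  fixes m i :: nat
  assumes "1 \<le> m" and "0 < i" and "i \<le> m"
  shows "strict_mono_on {0..} (higher_cf i m)"
proof (rule strict_mono_onI)
  fix x y :: real
  assume xy: "x \<in> {0..}" "y \<in> {0..}" "x < y"
  obtain p where p: "p \<in> \<rat>" "x < p" "p < y" using Rats_dense_in_real[OF xy(3)] by blast
  obtain q where q: "q \<in> \<rat>" "p < q" "q < y" using Rats_dense_in_real[OF p(3)] by blast
  have "higher_cf i m x \<le> higher_cf_rat i m p"
    using xy p assms by (intro higher_cf_rational_bounds(2)) auto
  also have "\<dots> < higher_cf_rat i m q"
    using xy p q assms by (intro higher_cf_rat_strict_mono) auto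
  also have "\<dots> \<le> higher_cf i m y"
    using xy p q assms by (intro higher_cf_rational_bounds(1)) auto
  finally show "higher_cf i m x < higher_cf i m y" .
qed

end
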